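(* Let $A\in\mathbb{R}\setminus\{0\}$ and $B,a_0,b_0\in\mathbb{R}$ with $a_0+b_0=B$, and put $a(\epsilon)=a_0+\frac{A}{\epsilon}$, $b(\epsilon)=b_0-\frac{A}{\epsilon}$ for $\epsilon\in(0,1]$; assume $b(\epsilon)\ne0$ for all $\epsilon\in(0,1]$. Let $L>0$, let $0\neq\psi\in L^2(\mathbb{R},dx)$ have support contained in $[-L,L]$, let $p_0=\frac{\pi}{AL}$ and let $q_0\in\mathbb{R}$ satisfy $|q_0p_0|<2\pi$. Suppose there is a constant $\chi>0$ with $\sum_{n\in\mathbb{Z}}|\psi(x+nq_0)|^2=\chi$ for all $x\in\mathbb{R}$. For $\epsilon\in(0,1]$ and $m,n\in\mathbb{Z}$ let $$\alpha_n(\epsilon)=e^{-\epsilon nq_0},\qquad \beta_{mn}(\epsilon)=-\frac{2\pi m\,e^{-\epsilon nq_0}}{b(\epsilon)(e^{\epsilon L}-e^{-\epsilon L})},\qquad \gamma_{mn}(\epsilon)=\beta_{mn}(\epsilon)\frac{\ln\alpha_n(\epsilon)}{\alpha_n(\epsilon)-1},$$ and $$\big|\psi^{\epsilon,a(\epsilon),b(\epsilon)}_{(n,m)}\big\rangle=\rho_\epsilon^{a(\epsilon),b(\epsilon)}\big(\alpha_n(\epsilon),\beta_{mn}(\epsilon),\gamma_{mn}(\epsilon)\big)(Q_\epsilon\psi),\qquad Q_\epsilon(x)=e^{-\frac12\epsilon x}.$$ Then for every $\epsilon\in(0,1]$ the sequence $\{|\psi^{\epsilon,a(\epsilon),b(\epsilon)}_{(n,m)}\rangle\}_{m,n\in\mathbb{Z}}$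 is a tight frame in $L^2(\mathbb{R},dx)$ with frame constant $2\frac{\sinh(\epsilon L)}{\epsilon}\chi$.
   Context: For $\epsilon\in(0,1]$, $a\in\mathbb{R}$, $b\in\mathbb{R}\setminus\{0\}$, $\rho_\epsilon^{a,b}$ is the unitary representation on $L^2(\mathbb{R})$ of the extended affine group $EA=\mathbb{R}^+\times\mathbb{R}\times\mathbb{R}$ (product $(\alpha,\beta,\gamma)(x,y,z)=(\alpha x,\alpha y+\beta,\gamma+z)$) given by $(\rho_\epsilon^{a,b}(\alpha,\beta,\gamma)f)(x)=e^{ia\gamma}e^{ib\beta e^{-\epsilon x}}f\big(x-\tfrac{\log\alpha}{\epsilon}\big)$. The quotient $\frac{\ln\alpha}{\alpha-1}$ is read as $1$ at $\alpha=1$. $Q_\epsilon\psi$ is the pointwise product. A countable family $\{\phi_k\}$ in a Hilbert space is a tight frame with frame constant $K>0$ if $\sum_k|\phi_k\rangle\langle\phi_k|=K\,\mathbb{I}$, equivalently $\sum_k|\langle f|\phi_k\rangle|^2=K\|f\|^2$ for all $f$. *)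

theory Defs
  imports "HOL-Analysis.Analysis"
begin

(* Elements of L^2(R,dx) are handled through Borel measurable representatives;
   equality in L^2 is equality almost everywhere with respect to lborel. *)
definition L2R :: "(real \<Rightarrow> complex) set" where
  "L2R = {f \<in> borel_measurable lborel. integrable lborel (\<lambda>x. (cmod (f x))\<^sup>2)}"

definition L2_inner :: "(real \<Rightarrow> complex) \<Rightarrow> (real \<Rightarrow> complex) \<Rightarrow> complex" where
  "L2_inner f g = (LINT x|lborel. cnj (f x) * g x)"

definition L2_nrm :: "(real \<Rightarrow> complex) \<Rightarrow> real" where
  "L2_nrm f = sqrt (LINT x|lborel. (cmod (f x))\<^sup>2)"

definition tight_frame :: "'i set \<Rightarrow> ('i \<Rightarrow> real \<Rightarrow> complex) \<Rightarrow> real \<Rightarrow> bool" where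
  "tight_frame I \<phi> K \<longleftrightarrow>
     countable I \<and> K > 0 \<and> (\<forall>k\<in>I. \<phi> k \<in> L2R) \<and>
     (\<forall>f\<in>L2R. ((\<lambda>k. (cmod (L2_inner f (\<phi> k)))\<^sup>2) has_sum K * (L2_nrm f)\<^sup>2) I)"

(* The extended affine group: triples (\<alpha>, \<beta>, \<gamma>) with \<alpha> > 0. *)
definition EA :: "(real \<times> real \<times> real) set" where
  "EA = {0<..} \<times> UNIV \<times> UNIV"

fun EA_mult :: "real \<times> real \<times> real \<Rightarrow> real \<times> real \<times> real \<Rightarrow> real \<times> real \<times> real" where
  "EA_mult (\<alpha>, \<beta>, \<gamma>) (x, y, z) = (\<alpha> * x, \<alpha> * y + \<beta>, \<gamma> + z)"

fun rho :: "real \<Rightarrow> real \<Rightarrow> real \<Rightarrow> real \<times> real \<times> real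
    \<Rightarrow> (real \<Rightarrow> complex) \<Rightarrow> real \<Rightarrow> complex" where
  "rho \<epsilon> a b (\<alpha>, \<beta>, \<gamma>) f x =
     exp (\<i> * of_real (a * \<gamma>)) * exp (\<i> * of_real (b * \<beta> * exp (- \<epsilon> * x)))
       * f (x - ln \<alpha> / \<epsilon>)"

lemma rho_EA_mult:
  assumes "\<epsilon> \<noteq> 0" "g \<in> EA" "h \<in> EA"
  shows "rho \<epsilon> a b (EA_mult g h) f = rho \<epsilon> a b g (rho \<epsilon> a b h f)"
proof -
  obtain \<alpha> \<beta> \<gamma> x y z where g: "g = (\<alpha>, \<beta>, \<gamma>)" and h: "h = (x, y, z)"
    by (metis prod_cases3)
  have pos: "\<alpha> > 0" "x > 0" using assms(2,3) by (auto simp: g h EA_def)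
  have e: "exp (- \<epsilon> * (t - ln \<alpha> / \<epsilon>)) = \<alpha> * exp (- \<epsilon> * t)" for t
  proof -
    have "- \<epsilon> * (t - ln \<alpha> / \<epsilon>) = ln \<alpha> + - \<epsilon> * t"
      using assms(1) by (simp add: field_simps)
    then show ?thesis using pos by (simp only: exp_add exp_ln)
  qed
  have l: "t - ln (\<alpha> * x) / \<epsilon> = t - ln \<alpha> / \<epsilon> - ln x / \<epsilon>" for t
    using pos by (simp add: ln_mult add_divide_distrib)
  show ?thesis
    unfolding g h EA_mult.simps
    by (rule ext) (simp only: rho.simps e l mult.assoc[symmetric] exp_add[symmetric],
      simp add: exp_add[symmetric] algebra_simps)
qed

definition log_quot :: "real \<Rightarrow> real" where
  "log_quot \<alpha> = (if \<alpha> = 1 then 1 else ln \<alpha> / (\<alpha> - 1))"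

end

(* Put u = exp (- \<epsilon> y). On [-L, L] the variable u runs through an interval of length
   D = exp (\<epsilon> L) - exp (- \<epsilon> L), and up to a unimodular factor the frame coefficient with index
   (n, m) is the m-th Fourier coefficient, in u, of the function conj (f (y - n q0)) * \<psi> y (with
   the Jacobian shared between the integrand and du). Parseval's identity on that interval sums
   the squares over m to (D / \<epsilon>) * integral of |f (x)|^2 |\<psi> (x + n q0)|^2, and the partition
   hypothesis then sums over n. Parseval's identity itself is obtained by transport to the unit
   circle: by Stone-Weierstrass and inner regularity, Laurent polynomials are dense in L^2 of any
   finite Borel measure on the circle. *)

theory Submission
  imports Defs "HOL-Complex_Analysis.Cauchy_Integral_Theorem"
begin

section \<open>Density of Laurent polynomials on the unit circle\<close>

text \<open>Since \<open>ln (\<alpha> \<epsilon> n) = - \<epsilon> * n * q0\<close>, the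
  representation translates by n q0, and the same exponential inside \<open>\<beta>\<close> turns
  exp (- \<epsilon> x) into exp (- \<epsilon> (x + n q0)). So, up to the constant phase coming from
  \<open>\<gamma>\<close>, every frame vector is a translate of a vector that depends on m alone,
  and one Parseval identity on one interval serves all n. \<open>Q\<close> is the square root of the
  Jacobian \<epsilon> exp (- \<epsilon> y) up to a constant; this is why the L^2 norm in u becomes
  the unweighted norm in y with a factor 1 / \<epsilon>, and D / \<epsilon> = 2 sinh (\<epsilon> L)
  / \<epsilon> is the first factor of the frame constant. The hard half of Parseval is completeness:
  orthogonality alone gives only Bessel's inequality. Density is shown for any finite Borel measure
  carried by the circle, so the image of the weighted measure on [-L, L] need not be computed; only
  its nonzero moments must vanish. A function on [-L, L] is moved to the circle through a measurable
  left inverse of the wrapping map, which exists almost everywhere.\<close>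

definition laurent_sum :: "int set \<Rightarrow> (int \<Rightarrow> complex) \<Rightarrow> complex \<Rightarrow> complex" where
  "laurent_sum F c z = (\<Sum>k\<in>F. c k * z powi k)"

lemma borel_measurable_power_int [measurable]:
  "(\<lambda>z::complex. z powi k) \<in> borel_measurable borel"
  unfolding power_int_def by (cases "k \<ge> 0") simp_all

lemma borel_measurable_laurent_sum [measurable]: "laurent_sum F c \<in> borel_measurable borel"
  unfolding laurent_sum_def by measurable

lemma laurent_sum_add:
  assumes "finite F" "finite G"
  shows "\<exists>H e. finite H \<and> (\<forall>z. laurent_sum H e z = laurent_sum F c z + laurent_sum G d z)"
proof (intro exI conjI allI)
  let ?e = "\<lambda>k. (if k \<in> F then c k else 0) + (if k \<in> G then d k else 0)"
  show "finite (F \<union> G)" using assms by simp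
  fix z
  have 1: "(\<Sum>k\<in>F \<union> G. (if k \<in> F then c k else 0) * z powi k) = laurent_sum F c z"
    unfolding laurent_sum_def using assms by (intro sum.mono_neutral_cong_right) auto
  have 2: "(\<Sum>k\<in>F \<union> G. (if k \<in> G then d k else 0) * z powi k) = laurent_sum G d z"
    unfolding laurent_sum_def using assms by (intro sum.mono_neutral_cong_right) auto
  show "laurent_sum (F \<union> G) ?e z = laurent_sum F c z + laurent_sum G d z"
    unfolding 1[symmetric] 2[symmetric] by (simp add: laurent_sum_def ring_distribs sum.distrib)
qed

(* Only values on the circle matter: at 0 the product of z powi k and z powi l
   may differ from z powi (k + l). *)
inductive circle_poly :: "(complex \<Rightarrow> complex) \<Rightarrow> bool" where
  monom: "(\<And>z. cmod z = 1 \<Longrightarrow> f z = c * z powi k) \<Longrightarrow> circle_poly f"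
| add: "circle_poly f \<Longrightarrow> circle_poly g \<Longrightarrow> (\<And>z. cmod z = 1 \<Longrightarrow> h z = f z + g z)
    \<Longrightarrow> circle_poly h"

lemma circle_poly_mult:
  assumes "circle_poly f" "circle_poly g" "\<And>z. cmod z = 1 \<Longrightarrow> h z = f z * g z"
  shows "circle_poly h"
  using assms
proof (induction arbitrary: h)
  case (monom f c k)
  from monom(2,1,3) show ?case
  proof (induction arbitrary: h)
    case (monom g d l)
    have "h z = (c * d) * z powi (k + l)" if "cmod z = 1" for z
    proof -
      from that have "z \<noteq> 0" by auto
      then show ?thesis using monom that by (simp add: power_int_add)
    qed
    then show ?case by (rule circle_poly.monom)
  next
    case (add g1 g2 g)
    have "circle_poly (\<lambda>z. f z * g1 z)" by (rule add.IH(1)) (use add in auto)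
    moreover have "circle_poly (\<lambda>z. f z * g2 z)" by (rule add.IH(2)) (use add in auto)
    ultimately show ?case
      by (rule circle_poly.add) (use add in \<open>simp add: ring_distribs\<close>)
  qed
next
  case (add f1 f2 f)
  have "circle_poly (\<lambda>z. f1 z * g z)" by (rule add.IH(1)) (use add in auto)
  moreover have "circle_poly (\<lambda>z. f2 z * g z)" by (rule add.IH(2)) (use add in auto)
  ultimately show ?case
    by (rule circle_poly.add) (use add in \<open>simp add: ring_distribs\<close>)
qed

text \<open>On the circle \<open>cnj z\<close> equals \<open>z powi (-1)\<close>, so real parts of
  \<open>c * z\<close> are Laurent polynomials there. Real-linear functionals generate the real
  polynomial functions of the plane, which makes this the link to Stone-Weierstrass.\<close>

lemma circle_poly_linear:
  assumes "bounded_linear (f :: complex \<Rightarrow> real)"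
  shows "circle_poly (\<lambda>z. of_real (f z))"
proof -
  interpret f: bounded_linear f by fact
  have fz: "f z = Re z * f 1 + Im z * f \<i>" for z
  proof -
    have "f z = f (Re z *\<^sub>R 1 + Im z *\<^sub>R \<i>)"
      by (rule arg_cong[of _ _ f]) (simp add: complex_eq_iff)
    also have "\<dots> = Re z * f 1 + Im z * f \<i>" by (simp only: f.add f.scale real_scaleR_def)
    finally show ?thesis .
  qed
  \<comment> \<open>Chosen so that \<open>f z\<close> is twice the real part of
    \<open>c * z\<close>.\<close>
  define c where "c = (of_real (f 1) - \<i> * of_real (f \<i>)) / 2"
  have "of_real (f z) = c * z powi 1 + cnj c * z powi (-1)" if "cmod z = 1" for z
  proof -
    have "z * cnj z = 1" using that by (simp add: complex_norm_square[symmetric])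
    then have "z powi (-1) = cnj z" by (simp add: power_int_minus inverse_unique)
    then have "c * z powi 1 + cnj c * z powi (-1) = c * z + cnj (c * z)" by simp
    also have "\<dots> = of_real (2 * Re (c * z))" by (rule complex_add_cnj)
    also have "2 * Re (c * z) = f z"
      by (simp add: fz[of z] c_def)
    finally show ?thesis by (rule sym)
  qed
  moreover have "circle_poly (\<lambda>z. c * z powi 1)" "circle_poly (\<lambda>z. cnj c * z powi (-1))"
    by (rule circle_poly.monom, rule refl)+
  ultimately show ?thesis by (rule circle_poly.add[rotated 2])
qed

lemma circle_poly_real_polynomial_function:
  assumes "real_polynomial_function p"
  shows "circle_poly (\<lambda>z. of_real (p z))"
  using assms
proof induction
  case (linear f) then show ?case by (rule circle_poly_linear)
next
  case (const c) show ?case by (rule circle_poly.monom[of _ "of_real c" 0]) simp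
next
  case (add f g)
  from circle_poly.add[OF add.IH] show ?case by simp
next
  case (mult f g)
  from circle_poly_mult[OF mult.IH] show ?case by simp
qed

lemma circle_poly_laurent_sum:
  assumes "circle_poly f"
  shows "\<exists>F c. finite F \<and> (\<forall>z. cmod z = 1 \<longrightarrow> f z = laurent_sum F c z)"
  using assms
proof induction
  case (monom f c k)
  then show ?case by (intro exI[of _ "{k}"] exI[of _ "\<lambda>_. c"]) (simp add: laurent_sum_def)
next
  case (add f g h)
  then show ?case by (metis laurent_sum_add)
qed

text \<open>The triangle inequality in a form that survives integration of squares. Its two factors
  2 are the reason for the errors \<open>\<delta> / 4\<close> below.\<close>

lemma cmod_diff_triangle_sq: "(cmod (x - z))\<^sup>2 \<le> 2 * (cmod (x - y))\<^sup>2 + 2 * (cmod (y - z))\<^sup>2"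
proof -
  have "cmod (x - z) \<le> cmod (x - y) + cmod (y - z)"
    by (metis norm_triangle_ineq add_diff_cancel diff_add_cancel diff_diff_eq2 add_diff_eq)
  then have "(cmod (x - z))\<^sup>2 \<le> (cmod (x - y) + cmod (y - z))\<^sup>2" by (intro power_mono) auto
  also have "\<dots> \<le> 2 * (cmod (x - y))\<^sup>2 + 2 * (cmod (y - z))\<^sup>2"
    using sum_squares_ge_zero[of "cmod (x - y) - cmod (y - z)" 0]
    by (simp add: power2_eq_square algebra_simps)
  finally show ?thesis .
qed

section \<open>Approximation in L^2 of a finite measure carried by the circle\<close>

locale circle_measure = finite_measure N for N :: "complex measure" +
  assumes sets_N [measurable_cong, simp]: "sets N = sets borel"
    and AE_circle: "AE z in N. cmod z = 1"
begin

lemma space_N [simp]: "space N = UNIV"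
  using sets_eq_imp_space_eq[OF sets_N] by simp

text \<open>Membership in the L^2 closure of the Laurent polynomials. The nonnegative integral keeps
  integrability conditions out of the definition.\<close>

definition approx :: "(complex \<Rightarrow> complex) \<Rightarrow> bool" where
  "approx H \<longleftrightarrow> (\<forall>\<delta>>0. \<exists>F c. finite F \<and>
     (\<integral>\<^sup>+z. ennreal ((cmod (H z - laurent_sum F c z))\<^sup>2) \<partial>N) \<le> ennreal \<delta>)"

lemma nn_integral_diff_triangle_sq:
  assumes [measurable]: "f \<in> borel_measurable N" "g \<in> borel_measurable N" "h \<in> borel_measurable N"
  shows "(\<integral>\<^sup>+z. ennreal ((cmod (f z - h z))\<^sup>2) \<partial>N)
     \<le> 2 * (\<integral>\<^sup>+z. ennreal ((cmod (f z - g z))\<^sup>2) \<partial>N) + 2 * (\<integral>\<^sup>+z. ennreal ((cmod (g z - h z))\<^sup>2) \<partial>N)"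
proof -
  have "(\<integral>\<^sup>+z. ennreal ((cmod (f z - h z))\<^sup>2) \<partial>N)
    \<le> (\<integral>\<^sup>+z. (2 * ennreal ((cmod (f z - g z))\<^sup>2) + 2 * ennreal ((cmod (g z - h z))\<^sup>2)) \<partial>N)"
  proof (rule nn_integral_mono)
    fix z
    have "ennreal ((cmod (f z - h z))\<^sup>2) \<le> ennreal (2 * (cmod (f z - g z))\<^sup>2 + 2 * (cmod (g z - h z))\<^sup>2)"
      by (rule ennreal_leI) (rule cmod_diff_triangle_sq)
    then show "ennreal ((cmod (f z - h z))\<^sup>2)
        \<le> 2 * ennreal ((cmod (f z - g z))\<^sup>2) + 2 * ennreal ((cmod (g z - h z))\<^sup>2)"
      by (simp add: ennreal_mult ennreal_plus)
  qed
  also have "\<dots> = 2 * (\<integral>\<^sup>+z. ennreal ((cmod (f z - g z))\<^sup>2) \<partial>N) + 2 * (\<integral>\<^sup>+z. ennreal ((cmod (g z - h z))\<^sup>2) \<partial>N)"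
    by (subst nn_integral_add) (simp_all add: nn_integral_cmult)
  finally show ?thesis .
qed

lemma approx_closed:
  assumes [measurable]: "H \<in> borel_measurable borel"
    and "\<And>\<delta>. \<delta> > 0 \<Longrightarrow> \<exists>G\<in>borel_measurable borel. approx G \<and>
      (\<integral>\<^sup>+z. ennreal ((cmod (H z - G z))\<^sup>2) \<partial>N) \<le> ennreal \<delta>"
  shows "approx H"
  unfolding approx_def
proof (intro allI impI)
  fix \<delta> :: real assume "\<delta> > 0"
  then obtain G where [measurable]: "G \<in> borel_measurable borel" and G: "approx G"
    and le: "(\<integral>\<^sup>+z. ennreal ((cmod (H z - G z))\<^sup>2) \<partial>N) \<le> ennreal (\<delta> / 4)"
    using assms(2)[of "\<delta> / 4"] by auto
  from G \<open>\<delta> > 0\<close> obtain F c where F: "finite F"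
    and le': "(\<integral>\<^sup>+z. ennreal ((cmod (G z - laurent_sum F c z))\<^sup>2) \<partial>N) \<le> ennreal (\<delta> / 4)"
    unfolding approx_def by (metis divide_pos_pos zero_less_numeral)
  have "(\<integral>\<^sup>+z. ennreal ((cmod (H z - laurent_sum F c z))\<^sup>2) \<partial>N)
    \<le> 2 * (\<integral>\<^sup>+z. ennreal ((cmod (H z - G z))\<^sup>2) \<partial>N)
      + 2 * (\<integral>\<^sup>+z. ennreal ((cmod (G z - laurent_sum F c z))\<^sup>2) \<partial>N)"
    by (rule nn_integral_diff_triangle_sq) simp_all
  also have "\<dots> \<le> 2 * ennreal (\<delta> / 4) + 2 * ennreal (\<delta> / 4)"
    by (intro add_mono mult_left_mono le le') auto
  also have "\<dots> = ennreal \<delta>"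
    using \<open>\<delta> > 0\<close>
    by (simp flip: ennreal_numeral ennreal_mult ennreal_plus)
  finally show "\<exists>F c. finite F \<and>
     (\<integral>\<^sup>+z. ennreal ((cmod (H z - laurent_sum F c z))\<^sup>2) \<partial>N) \<le> ennreal \<delta>"
    using F by blast
qed

text \<open>Dominated convergence applied to the squared error. The majorant bounds the difference
  \<open>H z - G i z\<close>: the constant 1 serves for tent functions, and the limit itself for
  increasing nonnegative sequences.\<close>

lemma approx_limit:
  assumes [measurable]: "H \<in> borel_measurable borel" "\<And>i. G i \<in> borel_measurable borel"
      "w \<in> borel_measurable borel"
    and G: "\<And>i::nat. approx (G i)"
    and lim: "\<And>z. (\<lambda>i. G i z) \<longlonglongrightarrow> H z"
    and bound: "\<And>i z. cmod (H z - G i z) \<le> w z"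
    and w: "(\<integral>\<^sup>+z. ennreal ((w z)\<^sup>2) \<partial>N) < \<infinity>"
  shows "approx H"
proof (rule approx_closed)
  fix \<delta> :: real assume "\<delta> > 0"
  have "(\<lambda>i. \<integral>\<^sup>+z. ennreal ((cmod (H z - G i z))\<^sup>2) \<partial>N) \<longlonglongrightarrow> (\<integral>\<^sup>+z. 0 \<partial>N)"
  proof (rule nn_integral_dominated_convergence[where w = "\<lambda>z. ennreal ((w z)\<^sup>2)"])
    show "AE z in N. ennreal ((cmod (H z - G i z))\<^sup>2) \<le> ennreal ((w z)\<^sup>2)" for i
      by (intro AE_I2 ennreal_leI power_mono bound) simp
    show "AE z in N. (\<lambda>i. ennreal ((cmod (H z - G i z))\<^sup>2)) \<longlonglongrightarrow> 0"
    proof (intro AE_I2)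
      fix z
      have "(\<lambda>i. (cmod (H z - G i z))\<^sup>2) \<longlonglongrightarrow> (cmod (H z - H z))\<^sup>2"
        by (intro tendsto_intros lim)
      then have "(\<lambda>i. ennreal ((cmod (H z - G i z))\<^sup>2)) \<longlonglongrightarrow> ennreal ((cmod (H z - H z))\<^sup>2)"
        by (rule tendsto_ennrealI)
      then show "(\<lambda>i. ennreal ((cmod (H z - G i z))\<^sup>2)) \<longlonglongrightarrow> 0" by simp
    qed
  qed (use w in simp_all)
  then have "(\<lambda>i. \<integral>\<^sup>+z. ennreal ((cmod (H z - G i z))\<^sup>2) \<partial>N) \<longlonglongrightarrow> 0" by simp
  moreover have "0 < ennreal \<delta>" using \<open>\<delta> > 0\<close> by simp
  ultimately have "\<forall>\<^sub>F i in sequentially. (\<integral>\<^sup>+z. ennreal ((cmod (H z - G i z))\<^sup>2) \<partial>N) < ennreal \<delta>"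
    by (rule order_tendstoD(2))
  then obtain i where "(\<integral>\<^sup>+z. ennreal ((cmod (H z - G i z))\<^sup>2) \<partial>N) < ennreal \<delta>"
    by (auto simp: eventually_sequentially)
  then show "\<exists>G\<in>borel_measurable borel. approx G \<and>
      (\<integral>\<^sup>+z. ennreal ((cmod (H z - G z))\<^sup>2) \<partial>N) \<le> ennreal \<delta>"
    using G[of i] by (intro bexI[of _ "G i"]) auto
qed fact

lemma approx_cmult:
  assumes [measurable]: "H \<in> borel_measurable borel" and H: "approx H"
  shows "approx (\<lambda>z. a * H z)"
  unfolding approx_def
proof (intro allI impI)
  fix \<delta> :: real assume "\<delta> > 0"
  \<comment> \<open>The added 1 keeps the denominator positive when a = 0.\<close>
  define \<eta> where "\<eta> = \<delta> / ((cmod a)\<^sup>2 + 1)"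
  have p: "(cmod a)\<^sup>2 + 1 > 0" by (smt (verit) zero_le_power2)
  have "\<eta> > 0" using \<open>\<delta> > 0\<close> p by (simp add: \<eta>_def)
  with H obtain F c where F: "finite F"
    and le: "(\<integral>\<^sup>+z. ennreal ((cmod (H z - laurent_sum F c z))\<^sup>2) \<partial>N) \<le> ennreal \<eta>"
    unfolding approx_def by blast
  have e: "a * H z - laurent_sum F (\<lambda>k. a * c k) z = a * (H z - laurent_sum F c z)" for z
    by (simp add: laurent_sum_def right_diff_distrib sum_distrib_left mult.assoc)
  have "(\<integral>\<^sup>+z. ennreal ((cmod (a * H z - laurent_sum F (\<lambda>k. a * c k) z))\<^sup>2) \<partial>N)
      = ennreal ((cmod a)\<^sup>2) * (\<integral>\<^sup>+z. ennreal ((cmod (H z - laurent_sum F c z))\<^sup>2) \<partial>N)"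
    by (simp add: e norm_mult power_mult_distrib ennreal_mult nn_integral_cmult)
  also have "\<dots> \<le> ennreal ((cmod a)\<^sup>2) * ennreal \<eta>" by (intro mult_left_mono le) auto
  also have "\<dots> = ennreal ((cmod a)\<^sup>2 * \<eta>)" using \<open>\<eta> > 0\<close> by (simp add: ennreal_mult)
  also have "\<dots> \<le> ennreal \<delta>"
    using \<open>\<delta> > 0\<close> p by (intro ennreal_leI) (simp add: \<eta>_def field_simps)
  finally show "\<exists>F c. finite F \<and>
     (\<integral>\<^sup>+z. ennreal ((cmod (a * H z - laurent_sum F c z))\<^sup>2) \<partial>N) \<le> ennreal \<delta>"
    using F by blast
qed

lemma approx_add:
  assumes [measurable]: "G \<in> borel_measurable borel" "H \<in> borel_measurable borel"
    and G: "approx G" and H: "approx H"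
  shows "approx (\<lambda>z. G z + H z)"
  unfolding approx_def
proof (intro allI impI)
  fix \<delta> :: real assume "\<delta> > 0"
  then have d: "\<delta> / 4 > 0" by simp
  from G d obtain F c where F: "finite F"
    and le1: "(\<integral>\<^sup>+z. ennreal ((cmod (G z - laurent_sum F c z))\<^sup>2) \<partial>N) \<le> ennreal (\<delta> / 4)"
    unfolding approx_def by blast
  from H d obtain F' c' where F': "finite F'"
    and le2: "(\<integral>\<^sup>+z. ennreal ((cmod (H z - laurent_sum F' c' z))\<^sup>2) \<partial>N) \<le> ennreal (\<delta> / 4)"
    unfolding approx_def by blast
  obtain K d where K: "finite K" "\<And>z. laurent_sum K d z = laurent_sum F c z + laurent_sum F' c' z"
    using laurent_sum_add[OF F F'] by blast
  have "(\<integral>\<^sup>+z. ennreal ((cmod (G z + H z - laurent_sum K d z))\<^sup>2) \<partial>N)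
    \<le> 2 * (\<integral>\<^sup>+z. ennreal ((cmod (G z + H z - (laurent_sum F c z + H z)))\<^sup>2) \<partial>N)
      + 2 * (\<integral>\<^sup>+z. ennreal ((cmod (laurent_sum F c z + H z - laurent_sum K d z))\<^sup>2) \<partial>N)"
    by (rule nn_integral_diff_triangle_sq) simp_all
  also have "\<dots> = 2 * (\<integral>\<^sup>+z. ennreal ((cmod (G z - laurent_sum F c z))\<^sup>2) \<partial>N)
      + 2 * (\<integral>\<^sup>+z. ennreal ((cmod (H z - laurent_sum F' c' z))\<^sup>2) \<partial>N)"
    by (simp add: K algebra_simps)
  also have "\<dots> \<le> 2 * ennreal (\<delta> / 4) + 2 * ennreal (\<delta> / 4)"
    by (intro add_mono mult_left_mono le1 le2) auto
  also have "\<dots> = ennreal \<delta>"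
    using \<open>\<delta> > 0\<close> by (simp flip: ennreal_numeral ennreal_mult ennreal_plus)
  finally show "\<exists>F c. finite F \<and>
     (\<integral>\<^sup>+z. ennreal ((cmod (G z + H z - laurent_sum F c z))\<^sup>2) \<partial>N) \<le> ennreal \<delta>"
    using K(1) by blast
qed

text \<open>Uniform approximation is needed on the unit sphere only, because \<open>N\<close> is
  carried by it; finite total mass turns the uniform error into an L^2 error.\<close>

lemma approx_continuous:
  assumes cont: "continuous_on UNIV (f :: complex \<Rightarrow> real)"
  shows "approx (\<lambda>z. of_real (f z))"
  unfolding approx_def
proof (intro allI impI)
  fix \<delta> :: real assume "\<delta> > 0"
  define D where "D = measure N UNIV"
  have "D \<ge> 0" by (simp add: D_def)
  \<comment> \<open>The squared error is at most \<eta>^2 times the mass \<open>D\<close>; the added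
    1 covers the zero measure.\<close>
  define \<eta> where "\<eta> = sqrt (\<delta> / (D + 1))"
  have "\<eta> > 0" using \<open>\<delta> > 0\<close> \<open>D \<ge> 0\<close> by (simp add: \<eta>_def)
  have "continuous_on (sphere 0 1) f" using cont continuous_on_subset by blast
  then obtain p where p: "real_polynomial_function p"
    and near: "\<And>z. z \<in> sphere 0 1 \<Longrightarrow> \<bar>f z - p z\<bar> < \<eta>"
    using Stone_Weierstrass_real_polynomial_function[of "sphere 0 1" f \<eta>] \<open>\<eta> > 0\<close>
    by (metis compact_sphere)
  obtain F c where F: "finite F" "\<And>z. cmod z = 1 \<Longrightarrow> of_real (p z) = laurent_sum F c z"
    using circle_poly_laurent_sum[OF circle_poly_real_polynomial_function[OF p]] by blast
  have "(\<integral>\<^sup>+z. ennreal ((cmod (of_real (f z) - laurent_sum F c z))\<^sup>2) \<partial>N)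
      \<le> (\<integral>\<^sup>+z. ennreal (\<eta>\<^sup>2) \<partial>N)"
    using AE_circle
  proof (intro nn_integral_mono_AE, eventually_elim)
    fix z :: complex assume z: "cmod z = 1"
    have "cmod (of_real (f z) - laurent_sum F c z) = \<bar>f z - p z\<bar>"
      by (simp add: F(2)[OF z, symmetric] flip: of_real_diff)
    also have "\<dots> \<le> \<eta>" using near[of z] z by simp
    finally show "ennreal ((cmod (of_real (f z) - laurent_sum F c z))\<^sup>2) \<le> ennreal (\<eta>\<^sup>2)"
      by (intro ennreal_leI power_mono) auto
  qed
  also have "\<dots> = ennreal (\<eta>\<^sup>2 * D)"
    by (simp add: D_def emeasure_eq_measure ennreal_mult)
  also have "\<dots> \<le> ennreal \<delta>"
    using \<open>\<delta> > 0\<close> \<open>D \<ge> 0\<close> by (intro ennreal_leI) (simp add: \<eta>_def field_simps)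
  finally show "\<exists>F c. finite F \<and>
     (\<integral>\<^sup>+z. ennreal ((cmod (of_real (f z) - laurent_sum F c z))\<^sup>2) \<partial>N) \<le> ennreal \<delta>"
    using F(1) by blast
qed

lemma nn_integral_const_finite: "(\<integral>\<^sup>+z. ennreal (c\<^sup>2) \<partial>N) < \<infinity>"
  by (simp add: emeasure_eq_measure ennreal_mult_less_top)

lemma approx_compact_indicator:
  assumes K: "compact K"
  shows "approx (\<lambda>z. of_real (indicator K z))"
\<comment> \<open>The empty set is separated because \<open>infdist z {}\<close> is 0, so that the
  tents below would be constantly 1.\<close>
proof (cases "K = {}")
  case True
  have "approx (\<lambda>z. of_real (0::real))" by (rule approx_continuous) simp
  then show ?thesis using True by simp
next
  case False
  have cl: "closed K" using K by (rule compact_imp_closed)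
  \<comment> \<open>Tents equal to 1 on \<open>K\<close>; outside the closed set \<open>K\<close>
    they vanish as soon as \<open>i\<close> exceeds the reciprocal of the distance.\<close>
  define f where "f i z = max 0 (1 - real i * infdist z K)" for i z
  have cont: "continuous_on UNIV (f i)" for i unfolding f_def
    by (intro continuous_intros)
  have [measurable]: "f i \<in> borel_measurable borel" for i
    using borel_measurable_continuous_onI[OF cont] .
  have [measurable]: "K \<in> sets borel" using cl by simp
  show ?thesis
  proof (rule approx_limit[where G = "\<lambda>i z. of_real (f i z)" and w = "\<lambda>_. 1"])
    show "approx (\<lambda>z. of_real (f i z))" for i by (rule approx_continuous) (rule cont)
    show "(\<lambda>i. of_real (f i z)) \<longlonglongrightarrow> (of_real (indicator K z) :: complex)" for z
    proof (cases "z \<in> K")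
      case True then show ?thesis by (simp add: f_def)
    next
      case zK: False
      then have pos: "infdist z K > 0"
        using cl False infdist_nonneg[of z K] in_closed_iff_infdist_zero[of K z] by force
      obtain j where j: "1 / infdist z K < real j" using reals_Archimedean2 by blast
      have "f i z = 0" if "i \<ge> j" for i
      proof -
        have "real i > 1 / infdist z K" using j that by linarith
        then have "real i * infdist z K > 1" using pos by (simp add: field_simps)
        then show ?thesis by (simp add: f_def)
      qed
      then have "\<forall>\<^sub>F i in sequentially. (of_real (f i z) :: complex) = of_real (indicator K z)"
        using zK by (auto simp: eventually_sequentially)
      then show ?thesis by (rule tendsto_eventually)
    qed
    show "cmod (of_real (indicator K z) - of_real (f i z)) \<le> 1" for i z
    proof -
      have "0 \<le> f i z" "f i z \<le> 1" by (auto simp: f_def infdist_nonneg)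
      then show ?thesis by (simp flip: of_real_diff add: indicator_def abs_if)
    qed
    show "(\<integral>\<^sup>+z. ennreal (1\<^sup>2) \<partial>N) < \<infinity>" by (rule nn_integral_const_finite)
  qed simp_all
qed

lemma approx_indicator:
  assumes B [measurable]: "B \<in> sets borel"
  shows "approx (\<lambda>z. of_real (indicator B z))"
proof (rule approx_closed)
  fix \<delta> :: real assume "\<delta> > 0"
  \<comment> \<open>Inner regularity. As the mass is finite, some compact subset comes within
    \<open>\<delta>\<close> of this supremum, and the squared error of its indicator is the mass of
    the difference set.\<close>
  have *: "emeasure N B = (SUP K \<in> {K. K \<subseteq> B \<and> compact K}. emeasure N K)"
    by (rule inner_regular) auto
  have "\<exists>K. K \<subseteq> B \<and> compact K \<and> emeasure N B \<le> emeasure N K + ennreal \<delta>"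
  proof (rule ccontr)
    assume no: "\<nexists>K. K \<subseteq> B \<and> compact K \<and> emeasure N B \<le> emeasure N K + ennreal \<delta>"
    have lt: "measure N K + \<delta> \<le> measure N B" if "K \<subseteq> B" "compact K" for K
    proof (rule ccontr)
      assume "\<not> measure N K + \<delta> \<le> measure N B"
      then have "ennreal (measure N B) \<le> ennreal (measure N K + \<delta>)"
        by (intro ennreal_leI) simp
      also have "\<dots> = emeasure N K + ennreal \<delta>"
        using \<open>\<delta> > 0\<close> by (simp add: emeasure_eq_measure)
      finally show False using that no by (simp add: emeasure_eq_measure)
    qed
    have "(SUP K \<in> {K. K \<subseteq> B \<and> compact K}. emeasure N K) \<le> ennreal (measure N B - \<delta>)"
    proof (rule SUP_least)
      fix K assume "K \<in> {K. K \<subseteq> B \<and> compact K}"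
      then have "measure N K \<le> measure N B - \<delta>" using lt[of K] by simp
      then show "emeasure N K \<le> ennreal (measure N B - \<delta>)"
        unfolding emeasure_eq_measure by (rule ennreal_leI)
    qed
    with * have "ennreal (measure N B) \<le> ennreal (measure N B - \<delta>)"
      by (simp add: emeasure_eq_measure)
    \<comment> \<open>The empty set is itself a compact competitor. Nonnegativity ensures that
      \<open>ennreal\<close> does not truncate the difference to 0, which would hide the
      contradiction.\<close>
    moreover have "measure N B - \<delta> \<ge> 0" using lt[of "{}"] by simp
    ultimately show False using \<open>\<delta> > 0\<close> by (simp add: ennreal_le_iff)
  qed
  then obtain K where K: "K \<subseteq> B" "compact K" "emeasure N B \<le> emeasure N K + ennreal \<delta>"
    by blast
  have [measurable]: "K \<in> sets borel" using K(2) by (simp add: compact_imp_closed)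
  have "(\<integral>\<^sup>+z. ennreal ((cmod (of_real (indicator B z) - of_real (indicator K z)))\<^sup>2) \<partial>N)
      = (\<integral>\<^sup>+z. indicator (B - K) z \<partial>N)"
    using K(1) by (intro nn_integral_cong) (auto split: split_indicator)
  also have "\<dots> = emeasure N B - emeasure N K"
    using K(1) by (simp add: emeasure_Diff)
  also have "\<dots> \<le> ennreal \<delta>"
    using K(3) by (simp add: ennreal_minus_le_iff)
  finally show "\<exists>G\<in>borel_measurable borel. approx G \<and>
      (\<integral>\<^sup>+z. ennreal ((cmod (of_real (indicator B z) - G z))\<^sup>2) \<partial>N) \<le> ennreal \<delta>"
    using approx_compact_indicator[OF K(2)]
    by (intro bexI[of _ "\<lambda>z. of_real (indicator K z)"]) auto
qed simp

text \<open>Square integrability is carried through the induction as a premise: nonnegative summands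
  and the members of an increasing sequence are dominated by the whole, so they inherit it.\<close>

lemma approx_nonneg:
  assumes [measurable]: "u \<in> borel_measurable borel" and nonneg: "\<And>z. 0 \<le> u z"
    and fin: "(\<integral>\<^sup>+z. ennreal ((u z)\<^sup>2) \<partial>N) < \<infinity>"
  shows "approx (\<lambda>z. of_real (u z))"
  using assms
proof (induction rule: borel_measurable_induct_real)
  case (set A)
  then show ?case using approx_indicator by simp
next
  case (mult u c)
  show ?case
  \<comment> \<open>For c = 0 the premise on the product says nothing about \<open>u\<close>, so the
    induction hypothesis is out of reach.\<close>
  proof (cases "c = 0")
    case True
    have "approx (\<lambda>z. of_real (0::real))" by (rule approx_continuous) simp
    then show ?thesis using True by simp
  next
    case False
    note [measurable] = mult.hyps(2)
    have "ennreal (c\<^sup>2) * (\<integral>\<^sup>+z. ennreal ((u z)\<^sup>2) \<partial>N) < \<infinity>"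
      using mult.prems by (simp add: power_mult_distrib ennreal_mult nn_integral_cmult)
    then have "(\<integral>\<^sup>+z. ennreal ((u z)\<^sup>2) \<partial>N) < \<infinity>"
      using False by (auto simp: ennreal_mult_less_top)
    then have "approx (\<lambda>z. of_real (u z))" by (rule mult.IH)
    then show ?thesis by (simp add: approx_cmult)
  qed
next
  case (add u v)
  note [measurable] = add.hyps(1,3)
  have "(\<integral>\<^sup>+z. ennreal ((u z)\<^sup>2) \<partial>N) \<le> (\<integral>\<^sup>+z. ennreal ((v z + u z)\<^sup>2) \<partial>N)"
    using add by (intro nn_integral_mono ennreal_leI power_mono) auto
  then have "approx (\<lambda>z. of_real (u z))" using add.IH(1) add.prems by (auto intro: le_less_trans)
  moreover have "(\<integral>\<^sup>+z. ennreal ((v z)\<^sup>2) \<partial>N) \<le> (\<integral>\<^sup>+z. ennreal ((v z + u z)\<^sup>2) \<partial>N)"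
    using add by (intro nn_integral_mono ennreal_leI power_mono) auto
  then have "approx (\<lambda>z. of_real (v z))" using add.IH(2) add.prems by (auto intro: le_less_trans)
  ultimately show ?case unfolding of_real_add by (intro approx_add) measurable
next
  case (seq U)
  note [measurable] = seq.hyps(1)
  have le: "U i z \<le> u z" for i z
    using seq.hyps(3) seq.hyps(4)[of z] by (intro incseq_le) (auto simp: incseq_def le_fun_def)
  have "approx (\<lambda>z. of_real (U i z))" for i
  proof (rule seq.IH)
    have "(\<integral>\<^sup>+z. ennreal ((U i z)\<^sup>2) \<partial>N) \<le> (\<integral>\<^sup>+z. ennreal ((u z)\<^sup>2) \<partial>N)"
      by (intro nn_integral_mono ennreal_leI power_mono le) (rule seq.hyps)
    then show "(\<integral>\<^sup>+z. ennreal ((U i z)\<^sup>2) \<partial>N) < \<infinity>" using fin by (auto intro: le_less_trans)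
  qed
  then show ?case
  \<comment> \<open>From 0 \<le> U i \<le> u the error is at most \<open>u\<close>, which is square
    integrable by assumption.\<close>
  proof (rule approx_limit[where w = u, rotated 3])
    show "(\<lambda>i. of_real (U i z)) \<longlonglongrightarrow> (of_real (u z) :: complex)" for z
      using seq.hyps(4)[of z] by (intro tendsto_of_real) simp
    show "cmod (of_real (u z) - of_real (U i z)) \<le> u z" for i z
      using le[where i=i and z=z] seq.hyps(2)[where i=i and x=z] by (simp flip: of_real_diff)
  qed (use fin in simp_all)
qed

text \<open>The positive and negative parts of \<open>Re\<close> and \<open>Im\<close> are all
  bounded by the modulus of \<open>H\<close>, so each is square integrable.\<close>

lemma approx_L2:
  assumes [measurable]: "H \<in> borel_measurable borel"
    and fin: "(\<integral>\<^sup>+z. ennreal ((cmod (H z))\<^sup>2) \<partial>N) < \<infinity>"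
  shows "approx H"
proof -
  have real: "approx (\<lambda>z. of_real (u z))"
    if [measurable]: "u \<in> borel_measurable borel" and le: "\<And>z. \<bar>u z\<bar> \<le> cmod (H z)"
    for u :: "complex \<Rightarrow> real"
  proof -
    have pos: "approx (\<lambda>z. of_real (v z))"
      if [measurable]: "v \<in> borel_measurable borel" and "\<And>z. 0 \<le> v z" "\<And>z. v z \<le> cmod (H z)"
      for v :: "complex \<Rightarrow> real"
    proof (rule approx_nonneg)
      have "(\<integral>\<^sup>+z. ennreal ((v z)\<^sup>2) \<partial>N) \<le> (\<integral>\<^sup>+z. ennreal ((cmod (H z))\<^sup>2) \<partial>N)"
        using that by (intro nn_integral_mono ennreal_leI power_mono) auto
      then show "(\<integral>\<^sup>+z. ennreal ((v z)\<^sup>2) \<partial>N) < \<infinity>" using fin by (auto intro: le_less_trans)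
    qed (use that in auto)
    have "approx (\<lambda>z. of_real (max 0 (u z)))" "approx (\<lambda>z. of_real (max 0 (- u z)))"
      by (rule pos; use le in \<open>auto simp: abs_le_iff\<close>)+
    then have "approx (\<lambda>z. of_real (max 0 (u z)) + (- 1) * of_real (max 0 (- u z)))"
      by (intro approx_add approx_cmult) simp_all
    also have "(\<lambda>z. of_real (max 0 (u z)) + (- 1) * of_real (max 0 (- u z)))
        = (\<lambda>z. of_real (u z) :: complex)"
      by (auto simp: fun_eq_iff max_def)
    finally show ?thesis .
  qed
  have "approx (\<lambda>z. of_real (Re (H z)))" "approx (\<lambda>z. of_real (Im (H z)))"
    by (rule real; simp add: abs_Re_le_cmod abs_Im_le_cmod)+
  then have "approx (\<lambda>z. of_real (Re (H z)) + \<i> * of_real (Im (H z)))"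
    by (intro approx_add approx_cmult) simp_all
  also have "(\<lambda>z. of_real (Re (H z)) + \<i> * of_real (Im (H z))) = H"
    by (simp add: complex_eq_iff fun_eq_iff)
  finally show ?thesis .
qed

end

section \<open>Parseval's identity\<close>

lemma borel_measurable_cnj [measurable]: "cnj \<in> borel_measurable borel"
  by (intro borel_measurable_continuous_onI continuous_intros)

text \<open>The vanishing moments express orthogonality of the powers of \<open>e\<close>, since on
  the circle e^j times the conjugate of e^k is e^(j - k).\<close>

locale circle_embedding = finite_measure M for M :: "'a measure" and e :: "'a \<Rightarrow> complex" +
  assumes e_measurable [measurable]: "e \<in> borel_measurable M"
    and norm_e: "x \<in> space M \<Longrightarrow> cmod (e x) = 1"
    and integral_e_powi: "k \<noteq> 0 \<Longrightarrow> (LINT x|M. e x powi k) = 0"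
    and measure_pos: "measure M (space M) > 0"
begin

abbreviation D where "D \<equiv> measure M (space M)"

abbreviation coeff where "coeff G k \<equiv> (LINT x|M. cnj (e x powi k) * G x)"

declare complex_cnj_power_int [simp del]

lemma norm_e_powi: "x \<in> space M \<Longrightarrow> cmod (e x powi k) = 1"
  by (simp add: norm_power_int norm_e)

lemma e_powi_mult_cnj: "x \<in> space M \<Longrightarrow> e x powi j * cnj (e x powi k) = e x powi (j - k)"
proof -
  assume x: "x \<in> space M"
  then have "e x \<noteq> 0" using norm_e by force
  have "e x powi k * cnj (e x powi k) = 1"
    using norm_e_powi[OF x, of k] by (simp only: complex_norm_square[symmetric]) simp
  then have "cnj (e x powi k) = inverse (e x powi k)"
    by (simp add: inverse_unique)
  then show ?thesis using \<open>e x \<noteq> 0\<close> by (simp add: power_int_diff divide_inverse)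
qed

lemma integral_e_powi_mult_cnj:
  "(LINT x|M. e x powi j * cnj (e x powi k)) = (if j = k then of_real D else 0)"
proof -
  have "(LINT x|M. e x powi j * cnj (e x powi k)) = (LINT x|M. e x powi (j - k))"
    by (intro Bochner_Integration.integral_cong e_powi_mult_cnj) auto
  then show ?thesis using integral_e_powi[of "j - k"] by (simp add: scaleR_conv_of_real)
qed

lemma integrable_e_powi_mult_cnj: "integrable M (\<lambda>x. e x powi j * cnj (e x powi k))"
  by (rule integrable_const_bound[where B = 1])
     (auto intro!: AE_I2 simp: norm_mult norm_e_powi)

lemma square_integrable_imp_integrable:
  assumes [measurable]: "G \<in> borel_measurable M" and "integrable M (\<lambda>x. (cmod (G x))\<^sup>2)"
  shows "integrable M G"
proof (rule Bochner_Integration.integrable_bound)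
  show "integrable M (\<lambda>x. 1 + (cmod (G x))\<^sup>2)" using assms by simp
  have "cmod w \<le> 1 + (cmod w)\<^sup>2" for w
    using zero_le_power2[of "cmod w - 1"] norm_ge_zero[of w]
    by (simp add: power2_eq_square algebra_simps del: norm_ge_zero)
  then show "AE x in M. cmod (G x) \<le> norm (1 + (cmod (G x))\<^sup>2)" by (intro AE_I2) (simp add: abs_of_nonneg)
qed fact

lemma integrable_coeff:
  assumes [measurable]: "G \<in> borel_measurable M" and "integrable M (\<lambda>x. (cmod (G x))\<^sup>2)"
  shows "integrable M (\<lambda>x. cnj (e x powi k) * G x)"
proof (rule Bochner_Integration.integrable_bound[OF square_integrable_imp_integrable[OF assms]])
  show "AE x in M. cmod (cnj (e x powi k) * G x) \<le> cmod (G x)"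
    by (intro AE_I2) (simp add: norm_mult norm_e_powi)
qed simp

text \<open>Expand the square, use orthogonality to collapse the double sum to its diagonal, and
  complete the square in each \<open>c k\<close>. The last sum, which is nonnegative and vanishes
  for \<open>c k = coeff G k / D\<close>, serves both halves of Parseval.\<close>

lemma integral_dist_laurent_sum:
  fixes c :: "int \<Rightarrow> complex"
  assumes G [measurable]: "G \<in> borel_measurable M" and G2: "integrable M (\<lambda>x. (cmod (G x))\<^sup>2)"
    and F: "finite F"
  shows "integrable M (\<lambda>x. (cmod (G x - laurent_sum F c (e x)))\<^sup>2)"
    and "(LINT x|M. (cmod (G x - laurent_sum F c (e x)))\<^sup>2) =
      (LINT x|M. (cmod (G x))\<^sup>2) - (\<Sum>k\<in>F. (cmod (coeff G k))\<^sup>2) / D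
        + (\<Sum>k\<in>F. (cmod (of_real D * c k - coeff G k))\<^sup>2) / D"
proof -
  let ?g = "coeff G"
  have exp: "of_real ((cmod (G x - laurent_sum F c (e x)))\<^sup>2) =
      of_real ((cmod (G x))\<^sup>2) - (\<Sum>k\<in>F. cnj (c k) * (cnj (e x powi k) * G x))
      - (\<Sum>k\<in>F. c k * cnj (cnj (e x powi k) * G x))
      + (\<Sum>j\<in>F. \<Sum>k\<in>F. c j * cnj (c k) * (e x powi j * cnj (e x powi k)))" for x
  proof -
    let ?P = "laurent_sum F c (e x)"
    have cP: "cnj ?P = (\<Sum>k\<in>F. cnj (c k) * cnj (e x powi k))"
      by (simp add: laurent_sum_def cnj_sum)
    have "of_real ((cmod (G x - ?P))\<^sup>2)
        = of_real ((cmod (G x))\<^sup>2) - cnj ?P * G x - ?P * cnj (G x) + ?P * cnj ?P"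
      unfolding complex_norm_square complex_cnj_diff by (simp add: algebra_simps)
    moreover have "cnj ?P * G x = (\<Sum>k\<in>F. cnj (c k) * (cnj (e x powi k) * G x))"
      unfolding cP by (simp add: sum_distrib_right mult.assoc)
    moreover have "?P * cnj (G x) = (\<Sum>k\<in>F. c k * cnj (cnj (e x powi k) * G x))"
      by (simp add: laurent_sum_def sum_distrib_right mult.assoc)
    moreover have "?P * cnj ?P = (\<Sum>j\<in>F. \<Sum>k\<in>F. c j * cnj (c k) * (e x powi j * cnj (e x powi k)))"
      unfolding cP unfolding laurent_sum_def sum_product by (intro sum.cong refl) (simp only: mult_ac)
    ultimately show ?thesis by simp
  qed
  have 1: "has_bochner_integral M (\<lambda>x. of_real ((cmod (G x))\<^sup>2) :: complex)
      (of_real (LINT x|M. (cmod (G x))\<^sup>2))"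
    using G2 by (intro has_bochner_integral_of_real has_bochner_integral_integrable)
  have 2: "has_bochner_integral M (\<lambda>x. cnj (e x powi k) * G x) (?g k)" for k
    by (intro has_bochner_integral_integrable integrable_coeff G G2)
  have 3: "has_bochner_integral M (\<lambda>x. cnj (cnj (e x powi k) * G x)) (cnj (?g k))" for k
    using has_bochner_integral_bounded_linear[OF bounded_linear_cnj 2[of k]] .
  have 4: "has_bochner_integral M (\<lambda>x. e x powi j * cnj (e x powi k)) (if j = k then of_real D else 0)" for j k
    unfolding integral_e_powi_mult_cnj[symmetric]
    by (intro has_bochner_integral_integrable integrable_e_powi_mult_cnj)
  have "has_bochner_integral M (\<lambda>x. of_real ((cmod (G x - laurent_sum F c (e x)))\<^sup>2) :: complex)
      (of_real (LINT x|M. (cmod (G x))\<^sup>2) - (\<Sum>k\<in>F. cnj (c k) * ?g k)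
      - (\<Sum>k\<in>F. c k * cnj (?g k))
      + (\<Sum>j\<in>F. \<Sum>k\<in>F. c j * cnj (c k) * (if j = k then of_real D else 0)))"
    unfolding exp
    by (intro has_bochner_integral_add has_bochner_integral_diff has_bochner_integral_sum
        has_bochner_integral_mult_right 1 2 3 4)
  note int = this[unfolded has_bochner_integral_iff]
  then show "integrable M (\<lambda>x. (cmod (G x - laurent_sum F c (e x)))\<^sup>2)"
    unfolding complex_of_real_integrable_eq by blast
  have "of_real (LINT x|M. (cmod (G x - laurent_sum F c (e x)))\<^sup>2)
      = (LINT x|M. of_real ((cmod (G x - laurent_sum F c (e x)))\<^sup>2) :: complex)"
    by (rule integral_complex_of_real[symmetric])
  also have "\<dots> = of_real (LINT x|M. (cmod (G x))\<^sup>2) - (\<Sum>k\<in>F. cnj (c k) * ?g k)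
      - (\<Sum>k\<in>F. c k * cnj (?g k))
      + (\<Sum>j\<in>F. \<Sum>k\<in>F. c j * cnj (c k) * (if j = k then of_real D else 0))"
    using int by blast
  also have "(\<Sum>j\<in>F. \<Sum>k\<in>F. c j * cnj (c k) * (if j = k then of_real D else 0))
      = (\<Sum>k\<in>F. c k * cnj (c k) * of_real D)"
    using F by (intro sum.cong) (auto simp: if_distrib cong: if_cong)
  also have "of_real (LINT x|M. (cmod (G x))\<^sup>2) - (\<Sum>k\<in>F. cnj (c k) * ?g k)
      - (\<Sum>k\<in>F. c k * cnj (?g k)) + (\<Sum>k\<in>F. c k * cnj (c k) * of_real D)
     = of_real (LINT x|M. (cmod (G x))\<^sup>2) +
       (\<Sum>k\<in>F. c k * cnj (c k) * of_real D - cnj (c k) * ?g k - c k * cnj (?g k))"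
    by (simp add: sum_subtractf)
  also have "(\<Sum>k\<in>F. c k * cnj (c k) * of_real D - cnj (c k) * ?g k - c k * cnj (?g k))
     = (\<Sum>k\<in>F. of_real ((cmod (of_real D * c k - ?g k))\<^sup>2 / D - (cmod (?g k))\<^sup>2 / D))"
  proof (rule sum.cong)
    fix k
    have "of_real ((cmod (of_real D * c k - ?g k))\<^sup>2 / D - (cmod (?g k))\<^sup>2 / D)
      = ((of_real D * c k - ?g k) * cnj (of_real D * c k - ?g k)) / D - ?g k * cnj (?g k) / D"
      by (simp only: of_real_diff of_real_divide complex_norm_square)
    also have "\<dots> = c k * cnj (c k) * of_real D - cnj (c k) * ?g k - c k * cnj (?g k)"
      using measure_pos by (simp add: field_simps)
    finally show "c k * cnj (c k) * of_real D - cnj (c k) * ?g k - c k * cnj (?g k)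
      = of_real ((cmod (of_real D * c k - ?g k))\<^sup>2 / D - (cmod (?g k))\<^sup>2 / D)" ..
  qed simp
  also have "of_real (LINT x|M. (cmod (G x))\<^sup>2)
      + (\<Sum>k\<in>F. complex_of_real ((cmod (of_real D * c k - ?g k))\<^sup>2 / D - (cmod (?g k))\<^sup>2 / D))
    = of_real ((LINT x|M. (cmod (G x))\<^sup>2) - (\<Sum>k\<in>F. (cmod (?g k))\<^sup>2) / D
        + (\<Sum>k\<in>F. (cmod (of_real D * c k - ?g k))\<^sup>2) / D)"
    by (simp only: of_real_sum[symmetric] of_real_add[symmetric])
       (simp add: sum_subtractf sum_divide_distrib)
  finally show "(LINT x|M. (cmod (G x - laurent_sum F c (e x)))\<^sup>2) =
      (LINT x|M. (cmod (G x))\<^sup>2) - (\<Sum>k\<in>F. (cmod (?g k))\<^sup>2) / D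
        + (\<Sum>k\<in>F. (cmod (of_real D * c k - ?g k))\<^sup>2) / D"
    unfolding of_real_eq_iff .
qed

text \<open>The left inverse \<open>r\<close> lets \<open>G\<close> factor through \<open>e\<close>
  almost everywhere, so density on the circle pulls back to \<open>M\<close>. Bessel bounds all
  finite sums from above, density brings them arbitrarily close to the bound. The factor
  \<open>D\<close> appears because \<open>coeff\<close> is not normalised.\<close>

theorem parseval:
  assumes G [measurable]: "G \<in> borel_measurable M" and G2: "integrable M (\<lambda>x. (cmod (G x))\<^sup>2)"
    and r [measurable]: "r \<in> borel \<rightarrow>\<^sub>M M" and inv: "AE x in M. r (e x) = x"
  shows "((\<lambda>k. (cmod (coeff G k))\<^sup>2) has_sum D * (LINT x|M. (cmod (G x))\<^sup>2)) UNIV"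
proof -
  let ?g = "\<lambda>k. (cmod (coeff G k))\<^sup>2" and ?S = "D * (LINT x|M. (cmod (G x))\<^sup>2)"
  have bessel: "sum ?g F \<le> ?S" if F: "finite F" for F
  proof -
    \<comment> \<open>These are the coefficients of the orthogonal projection, for which the last
      sum of the distance formula is zero.\<close>
    have "0 \<le> (LINT x|M. (cmod (G x - laurent_sum F (\<lambda>k. coeff G k / D) (e x)))\<^sup>2)" by simp
    also have "\<dots> = (LINT x|M. (cmod (G x))\<^sup>2) - sum ?g F / D"
      using measure_pos by (simp add: integral_dist_laurent_sum(2)[OF G G2 F])
    finally show ?thesis using measure_pos by (simp add: field_simps)
  qed
  interpret N: circle_measure "distr M borel e"
  proof (intro circle_measure.intro circle_measure_axioms.intro finite_measure_distr)
    show "AE z in distr M borel e. cmod z = 1"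
      by (subst AE_distr_iff) (auto intro: AE_I2 norm_e)
  qed simp_all
  have "AE x in M. G (r (e x)) = G x" using inv by eventually_elim simp
  \<comment> \<open>The extra argument of \<open>f\<close> is needed later for the distance to a
    Laurent sum, which depends on the point as well as on the value of \<open>G\<close>.\<close>
  then have GAE: "AE x in M. f (G (r (e x))) x = f (G x) x" for f :: "complex \<Rightarrow> 'a \<Rightarrow> ennreal"
    by eventually_elim simp
  have "(\<integral>\<^sup>+z. ennreal ((cmod (G (r z)))\<^sup>2) \<partial>distr M borel e) = (\<integral>\<^sup>+x. ennreal ((cmod (G (r (e x))))\<^sup>2) \<partial>M)"
    by (rule nn_integral_distr) simp_all
  also have "\<dots> = (\<integral>\<^sup>+x. ennreal ((cmod (G x))\<^sup>2) \<partial>M)"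
    by (intro nn_integral_cong_AE GAE)
  also have "\<dots> < \<infinity>" using G2 by (simp add: integrable_iff_bounded)
  finally have apx: "N.approx (\<lambda>z. G (r z))" by (intro N.approx_L2) simp_all
  have dense: "\<exists>F. finite F \<and> ?S - \<delta> \<le> sum ?g F" if "\<delta> > 0" for \<delta>
  proof -
    have "\<delta> / D > 0" using that measure_pos by simp
    then obtain F c where F: "finite F" and
      le: "(\<integral>\<^sup>+z. ennreal ((cmod (G (r z) - laurent_sum F c z))\<^sup>2) \<partial>distr M borel e) \<le> ennreal (\<delta> / D)"
      using apx unfolding N.approx_def by blast
    note le
    also have "(\<integral>\<^sup>+z. ennreal ((cmod (G (r z) - laurent_sum F c z))\<^sup>2) \<partial>distr M borel e)
       = (\<integral>\<^sup>+x. ennreal ((cmod (G (r (e x)) - laurent_sum F c (e x)))\<^sup>2) \<partial>M)"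
      by (rule nn_integral_distr) simp_all
    also have "\<dots> = (\<integral>\<^sup>+x. ennreal ((cmod (G x - laurent_sum F c (e x)))\<^sup>2) \<partial>M)"
      by (intro nn_integral_cong_AE GAE[where f = "\<lambda>w x. ennreal ((cmod (w - laurent_sum F c (e x)))\<^sup>2)"])
    also have "\<dots> = ennreal (LINT x|M. (cmod (G x - laurent_sum F c (e x)))\<^sup>2)"
      by (intro nn_integral_eq_integral integral_dist_laurent_sum(1)[OF G G2 F] AE_I2) simp
    finally have "(LINT x|M. (cmod (G x - laurent_sum F c (e x)))\<^sup>2) \<le> \<delta> / D"
      using \<open>\<delta> / D > 0\<close> by (simp add: ennreal_le_iff)
    then have "(LINT x|M. (cmod (G x))\<^sup>2) - sum ?g F / D + (\<Sum>k\<in>F. (cmod (of_real D * c k - coeff G k))\<^sup>2) / D \<le> \<delta> / D"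
      by (simp only: integral_dist_laurent_sum(2)[OF G G2 F])
    \<comment> \<open>Dropping this term replaces the approximating Laurent polynomial by the best
      one with the same exponents.\<close>
    moreover have "(\<Sum>k\<in>F. (cmod (of_real D * c k - coeff G k))\<^sup>2) / D \<ge> 0"
      using measure_pos by (intro divide_nonneg_pos sum_nonneg) auto
    ultimately have "(LINT x|M. (cmod (G x))\<^sup>2) - sum ?g F / D \<le> \<delta> / D" by linarith
    then have "D * ((LINT x|M. (cmod (G x))\<^sup>2) - sum ?g F / D) \<le> D * (\<delta> / D)"
      using measure_pos by (intro mult_left_mono) auto
    then have "?S - \<delta> \<le> sum ?g F" using measure_pos by (simp add: right_diff_distrib)
    then show ?thesis using F by blast
  qed
  show ?thesis unfolding has_sum_def
  proof (rule order_tendstoI)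
    fix a assume "a < ?S"
    then obtain F where F: "finite F" "?S - (?S - a) / 2 \<le> sum ?g F"
      using dense[of "(?S - a) / 2"] by auto
    have "a < sum ?g H" if "finite H" "F \<subseteq> H" for H
    proof -
      have "sum ?g F \<le> sum ?g H" using that by (intro sum_mono2) auto
      then show ?thesis using F(2) \<open>a < ?S\<close> by (simp add: field_simps)
    qed
    then show "\<forall>\<^sub>F F in finite_subsets_at_top UNIV. a < sum ?g F"
      using F(1) by (auto simp: eventually_finite_subsets_at_top)
  next
    fix a assume "?S < a"
    then show "\<forall>\<^sub>F F in finite_subsets_at_top UNIV. sum ?g F < a"
      using bessel by (auto simp: eventually_finite_subsets_at_top intro: le_less_trans)
  qed
qed

end

section \<open>Parseval's identity in the variable u = exp (- \<epsilon> y)\<close>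

lemma Im_Ln_cis: "-pi < t \<Longrightarrow> t \<le> pi \<Longrightarrow> Im (Ln (cis t)) = t"
  by (simp add: cis_conv_exp)

text \<open>The sum over m for one fixed n, with translation and phase removed; \<open>h\<close>
  stands for the product of \<open>\<psi>\<close> with the conjugate of a translate of
  \<open>f\<close>.\<close>

lemma chirp_parseval:
  fixes \<epsilon> L :: real and h :: "real \<Rightarrow> complex"
  defines "D \<equiv> exp (\<epsilon> * L) - exp (- \<epsilon> * L)"
  assumes \<epsilon>: "\<epsilon> > 0" and L: "L > 0"
    and h [measurable]: "h \<in> borel_measurable borel"
    and h2: "integrable lborel (\<lambda>y. (cmod (h y))\<^sup>2)"
    and supp: "AE y in lborel. y \<notin> {-L..L} \<longrightarrow> h y = 0"
  shows "((\<lambda>m::int. (cmod (LINT y|lborel.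
            cis (- (2 * pi * of_int m * exp (- \<epsilon> * y) / D)) * of_real (exp (- (\<epsilon> * y) / 2)) * h y))\<^sup>2)
          has_sum D / \<epsilon> * (LINT y|lborel. (cmod (h y))\<^sup>2)) UNIV"
proof -
  have D: "D > 0" using \<epsilon> L by (simp add: D_def)
  \<comment> \<open>The modulus of the Jacobian du/dy, cut off to [-L, L].\<close>
  define w where "w y = indicator {-L..L} y * (\<epsilon> * exp (- \<epsilon> * y))" for y :: real
  \<comment> \<open>The range of u has length \<open>D\<close>, so the angle makes exactly one full
    turn.\<close>
  define e where "e y = cis (2 * pi * exp (- \<epsilon> * y) / D)" for y
  define M where "M = density lborel (\<lambda>y. ennreal (w y))"
  have w_nonneg: "w y \<ge> 0" for y using \<epsilon> by (simp add: w_def)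
  have [measurable]: "w \<in> borel_measurable borel" unfolding w_def by measurable
  have [measurable]: "cis \<in> borel_measurable borel"
    by (intro borel_measurable_continuous_onI continuous_intros)
  have [measurable]: "e \<in> borel_measurable borel" unfolding e_def by measurable
  have sets_M [measurable_cong, simp]: "sets M = sets borel" by (simp add: M_def)
  have space_M [simp]: "space M = UNIV" by (simp add: M_def)
  \<comment> \<open>Stands in for the substitution u = exp (- \<epsilon> y); it yields both the
    total mass and the vanishing moments.\<close>
  have FTC: "(LINT y|M. g y) = F L - F (- L)"
    if F: "\<And>y. (F has_vector_derivative (\<epsilon> * exp (- \<epsilon> * y)) *\<^sub>R g y) (at y)"
      and g: "continuous_on UNIV g" for F and g :: "real \<Rightarrow> complex"
  proof -
    have [measurable]: "g \<in> borel_measurable borel" by (rule borel_measurable_continuous_onI[OF g])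
    have "(LINT y|M. g y) = (LINT y|lborel. w y *\<^sub>R g y)"
      unfolding M_def by (rule integral_density) (simp_all add: w_nonneg)
    also have "\<dots> = (LINT y|lborel. indicator {-L..L} y *\<^sub>R ((\<epsilon> * exp (- \<epsilon> * y)) *\<^sub>R g y))"
      by (simp add: w_def)
    also have "\<dots> = F L - F (- L)"
    proof (rule integral_FTC_atLeastAtMost)
      show "continuous_on {- L..L} (\<lambda>y. (\<epsilon> * exp (- \<epsilon> * y)) *\<^sub>R g y)"
        by (intro continuous_intros continuous_on_subset[OF g]) auto
    qed (use L F in \<open>auto intro: has_vector_derivative_at_within\<close>)
    finally show ?thesis .
  qed
  have "set_integrable lborel {-L..L} (\<lambda>y. \<epsilon> * exp (- \<epsilon> * y))"
    by (intro borel_integrable_atLeastAtMost' continuous_intros)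
  then have "integrable lborel w" by (simp add: set_integrable_def w_def[abs_def])
  then have "emeasure M UNIV < \<infinity>"
    by (simp add: M_def emeasure_density integrable_iff_bounded w_nonneg)
  then have fin: "finite_measure M" by (intro finite_measureI) simp
  have "of_real (measure M UNIV) = (LINT y|M. (1::complex))"
    by (simp add: scaleR_conv_of_real)
  also have "\<dots> = of_real (- exp (- \<epsilon> * L)) - of_real (- exp (- \<epsilon> * - L))"
    by (rule FTC) (auto intro!: derivative_eq_intros has_vector_derivative_of_real
        simp: scaleR_conv_of_real simp flip: has_real_derivative_iff_has_vector_derivative)
  also have "\<dots> = of_real D" by (simp add: D_def)
  finally have meas: "measure M UNIV = D" unfolding of_real_eq_iff .
  have e_powi: "e y powi k = cis (of_int k * (2 * pi * exp (- \<epsilon> * y) / D))" for y k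
    unfolding e_def by (simp add: cis_power_int)
  interpret circle_embedding M e
  proof (intro circle_embedding.intro circle_embedding_axioms.intro)
    fix k :: int assume k: "k \<noteq> 0"
    define c :: complex where "c = \<i> * of_real (of_int k * 2 * pi / D)"
    have c0: "c \<noteq> 0" using k D by (simp add: c_def)
    have e_c: "e y powi k = exp (c * of_real (exp (- \<epsilon> * y)))" for y
      unfolding e_powi cis_conv_exp c_def by (simp add: mult_ac)
    \<comment> \<open>An antiderivative; the minus sign arises because u decreases in y.\<close>
    define F where "F y = - exp (c * of_real (exp (- \<epsilon> * y))) / c" for y
    have "(LINT y|M. e y powi k) = F L - F (- L)"
    proof (rule FTC)
      fix y
      have "((\<lambda>z. - exp (c * exp (- of_real \<epsilon> * z)) / c) has_field_derivative
          of_real \<epsilon> * exp (- of_real \<epsilon> * of_real y) * exp (c * exp (- of_real \<epsilon> * of_real y))) (at (of_real y))"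
        using c0 by (auto intro!: derivative_eq_intros)
      from has_vector_derivative_real_field[OF this]
      show "(F has_vector_derivative (\<epsilon> * exp (- \<epsilon> * y)) *\<^sub>R (e y powi k)) (at y)"
        unfolding e_c F_def by (simp add: scaleR_conv_of_real exp_of_real[symmetric])
    next
      show "continuous_on UNIV (\<lambda>y. e y powi k)" unfolding e_c by (intro continuous_intros)
    qed
    \<comment> \<open>The exponents at the two endpoints differ by c times D, an integer multiple of
      2 pi i.\<close>
    also have "F L = F (- L)"
    proof -
      define K where "K = of_int k * 2 * pi / D"
      have "K * D = of_int (2 * k) * pi" using D by (simp add: K_def)
      moreover have "K * exp (\<epsilon> * L) = K * exp (- \<epsilon> * L) + K * D"
        unfolding D_def right_diff_distrib by simp
      ultimately have r: "of_int k * 2 * pi / D * exp (\<epsilon> * L) = of_int k * 2 * pi / D * exp (- \<epsilon> * L) + of_int (2 * k) * pi"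
        by (simp add: K_def)
      have "c * of_real (exp (\<epsilon> * L)) = \<i> * of_real (of_int k * 2 * pi / D * exp (\<epsilon> * L))"
        unfolding c_def by (simp only: of_real_mult mult.assoc)
      also have "\<dots> = \<i> * of_real (of_int k * 2 * pi / D * exp (- \<epsilon> * L)) + \<i> * of_real (of_int (2 * k) * pi)"
        unfolding r of_real_add by (rule distrib_left)
      also have "\<dots> = c * of_real (exp (- \<epsilon> * L)) + (of_int (2 * k) * pi) * \<i>"
        unfolding c_def by (simp only: of_real_mult mult.assoc of_real_of_int_eq) (simp add: mult_ac)
      finally have "exp (c * of_real (exp (\<epsilon> * L))) = exp (c * of_real (exp (- \<epsilon> * L)))"
        unfolding exp_eq by blast
      then show ?thesis by (simp add: F_def)
    qed
    finally show "(LINT y|M. e y powi k) = 0" by simp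
  qed (use fin D in \<open>simp_all add: meas e_def\<close>)
  (* a Borel left inverse of e, valid away from the endpoints, where e identifies -L and L *)
  define r where "r z = - ln (cosh (\<epsilon> * L) + D / (2 * pi) * Im (Ln (z * cis (- (2 * pi * cosh (\<epsilon> * L) / D))))) / \<epsilon>" for z
  have r_meas: "r \<in> borel \<rightarrow>\<^sub>M M" unfolding r_def by measurable
  have re: "r (e y) = y" if y: "-L < y" "y < L" for y
  proof -
    let ?u = "exp (- \<epsilon> * y)" and ?C = "cosh (\<epsilon> * L)"
    \<comment> \<open>\<open>?C\<close> is the midpoint of the range of u, so the rotation built
      into \<open>r\<close> centres the angle: \<open>t\<close> stays within the principal branch,
      where \<open>Im (Ln (cis t))\<close> returns it.\<close>
    define t where "t = 2 * pi * (?u - ?C) / D"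
    have DS: "D = 2 * sinh (\<epsilon> * L)" by (simp add: D_def sinh_field_def)
    have "?u < exp (\<epsilon> * L)" using y \<epsilon> mult_strict_left_mono[of "-y" L \<epsilon>] by simp
    moreover have "exp (- \<epsilon> * L) < ?u" using y \<epsilon> by simp
    moreover have "exp (\<epsilon> * L) = ?C + sinh (\<epsilon> * L)" "exp (- \<epsilon> * L) = ?C - sinh (\<epsilon> * L)"
      by (simp_all add: cosh_plus_sinh cosh_minus_sinh)
    ultimately have "- (D / 2) < ?u - ?C" "?u - ?C < D / 2"
      unfolding DS by linarith+
    then have "2 * pi * (- (D / 2)) < 2 * pi * (?u - ?C)" "2 * pi * (?u - ?C) < 2 * pi * (D / 2)"
      by (simp_all only: mult_less_cancel_left_pos pi_gt_zero zero_less_mult_iff zero_less_numeral simp_thms)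
    then have t: "- pi < t" "t \<le> pi" using D by (simp_all add: t_def field_simps)
    have "e y * cis (- (2 * pi * ?C / D)) = cis t"
      unfolding e_def cis_mult t_def
      by (rule arg_cong[of _ _ cis]) (simp add: right_diff_distrib diff_divide_distrib)
    then have "r (e y) = - ln (?C + D / (2 * pi) * t) / \<epsilon>"
      unfolding r_def using Im_Ln_cis[OF t] by simp
    also have "?C + D / (2 * pi) * t = ?u" using D by (simp add: t_def)
    finally show ?thesis using \<epsilon> by simp
  qed
  have inv: "AE y in M. r (e y) = y"
  proof -
    have "AE y in lborel. y \<noteq> L" "AE y in lborel. y \<noteq> -L"
      by (rule AE_lborel_singleton)+
    then have "AE y in lborel. 0 < ennreal (w y) \<longrightarrow> r (e y) = y"
      by eventually_elim (auto simp: w_def re indicator_def)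
    then show ?thesis unfolding M_def by (subst AE_density) auto
  qed
  \<comment> \<open>Solved from the requirement that \<open>w\<close> times \<open>G\<close> be exp
    (- \<epsilon> y / 2) times \<open>h\<close> on [-L, L]. Then \<open>w\<close> times the squared
    modulus of \<open>G\<close> is that of \<open>h\<close> divided by \<epsilon>, with no
    exponential left.\<close>
  define G where "G y = of_real (exp (\<epsilon> * y / 2) / \<epsilon>) * h y" for y
  have [measurable]: "G \<in> borel_measurable borel" unfolding G_def by measurable
  have wG: "AE y in lborel. w y *\<^sub>R (cmod (G y))\<^sup>2 = (cmod (h y))\<^sup>2 / \<epsilon>"
    using supp
  proof eventually_elim
    case (elim y)
    have "(exp (\<epsilon> * y / 2))\<^sup>2 = exp (\<epsilon> * y)" by (simp flip: exp_of_nat_mult)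
    moreover have "cmod (G y) = exp (\<epsilon> * y / 2) / \<epsilon> * cmod (h y)"
      unfolding G_def norm_mult norm_of_real using \<epsilon> by simp
    ultimately have "(cmod (G y))\<^sup>2 = exp (\<epsilon> * y) / \<epsilon>\<^sup>2 * (cmod (h y))\<^sup>2"
      by (simp add: power_mult_distrib power_divide)
    then have "\<epsilon> * exp (- \<epsilon> * y) * (cmod (G y))\<^sup>2 = (cmod (h y))\<^sup>2 / \<epsilon>"
      using \<epsilon> by (simp add: exp_minus power2_eq_square field_simps)
    then show ?case using elim by (auto simp: w_def indicator_def)
  qed
  have "integrable M (\<lambda>y. (cmod (G y))\<^sup>2)"
    unfolding M_def
    by (subst integrable_density, simp_all add: w_nonneg del: real_scaleR_def)
       (subst integrable_cong_AE[OF _ _ wG], use h2 in simp_all)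
  moreover have "(LINT y|M. (cmod (G y))\<^sup>2) = (LINT y|lborel. (cmod (h y))\<^sup>2) / \<epsilon>"
  proof -
    have "(LINT y|M. (cmod (G y))\<^sup>2) = (LINT y|lborel. w y *\<^sub>R (cmod (G y))\<^sup>2)"
      unfolding M_def by (rule integral_density) (simp_all add: w_nonneg)
    also have "\<dots> = (LINT y|lborel. (cmod (h y))\<^sup>2 / \<epsilon>)"
      by (rule integral_cong_AE[OF _ _ wG]) simp_all
    finally show ?thesis by simp
  qed
  moreover have "coeff G m = (LINT y|lborel.
      cis (- (2 * pi * of_int m * exp (- \<epsilon> * y) / D)) * of_real (exp (- (\<epsilon> * y) / 2)) * h y)" for m
  proof -
    have "coeff G m = (LINT y|lborel. w y *\<^sub>R (cnj (e y powi m) * G y))"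
      unfolding M_def by (rule integral_density) (simp_all add: w_nonneg)
    also have "\<dots> = (LINT y|lborel.
      cis (- (2 * pi * of_int m * exp (- \<epsilon> * y) / D)) * of_real (exp (- (\<epsilon> * y) / 2)) * h y)"
    proof (rule integral_cong_AE)
      show "AE y in lborel. w y *\<^sub>R (cnj (e y powi m) * G y)
          = cis (- (2 * pi * of_int m * exp (- \<epsilon> * y) / D)) * of_real (exp (- (\<epsilon> * y) / 2)) * h y"
        using supp
      proof eventually_elim
        case (elim y)
        have "exp (- \<epsilon> * y) * exp (\<epsilon> * y / 2) = exp (- (\<epsilon> * y) / 2)"
          by (simp flip: exp_add)
        then have 1: "\<epsilon> * exp (- \<epsilon> * y) * (exp (\<epsilon> * y / 2) / \<epsilon>) = exp (- (\<epsilon> * y) / 2)"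
          using \<epsilon> by simp
        have 2: "cnj (e y powi m) = cis (- (2 * pi * of_int m * exp (- \<epsilon> * y) / D))"
          unfolding e_powi cis_cnj[symmetric] by (simp add: mult_ac)
        have "(\<epsilon> * exp (- \<epsilon> * y)) *\<^sub>R (cnj (e y powi m) * G y)
          = cis (- (2 * pi * of_int m * exp (- \<epsilon> * y) / D)) * of_real (exp (- (\<epsilon> * y) / 2)) * h y"
          unfolding 1[symmetric] 2 G_def scaleR_conv_of_real of_real_mult by (simp only: mult_ac)
        then show ?case using elim by (auto simp: w_def indicator_def)
      qed
    qed simp_all
    finally show ?thesis .
  qed
  ultimately show ?thesis
    using parseval[of G r] r_meas inv by (simp add: meas)
qed

text \<open>Sum and integral are exchanged by dominated convergence: nonnegative partial sums of the
  partition stay below c, so \<open>F x * c\<close> is a majorant.\<close>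

lemma has_sum_integral_partition:
  fixes F :: "'a \<Rightarrow> real" and g :: "int \<Rightarrow> 'a \<Rightarrow> real"
  assumes [measurable]: "\<And>n. g n \<in> borel_measurable M"
    and F: "integrable M F" "\<And>x. 0 \<le> F x" and g: "\<And>n x. 0 \<le> g n x"
    and sum: "\<And>x. ((\<lambda>n. g n x) has_sum c) UNIV"
  shows "((\<lambda>n. LINT x|M. F x * g n x) has_sum (LINT x|M. F x) * c) UNIV"
proof -
  note [measurable] = borel_measurable_integrable[OF F(1)]
  \<comment> \<open>Dominated convergence works along sequences, hence the enumeration of the
    integers by \<open>int_decode\<close>.\<close>
  have sums: "(\<lambda>i. g (int_decode i) x) sums c" for x
    using sum[of x] unfolding has_sum_reindex_bij_betw[OF bij_int_decode, symmetric]
    by (rule has_sum_imp_sums)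
  have part: "(\<Sum>i<N. F x * g (int_decode i) x) \<le> F x * c" for N x
  proof -
    have "(\<Sum>i<N. g (int_decode i) x) \<le> (\<Sum>i. g (int_decode i) x)"
      using g by (intro sum_le_suminf sums_summable[OF sums]) auto
    then show ?thesis
      unfolding sums_unique[OF sums, symmetric] sum_distrib_left[symmetric]
      by (rule mult_left_mono) (rule F(2))
  qed
  have int: "integrable M (\<lambda>x. F x * g n x)" for n
  proof (rule Bochner_Integration.integrable_bound)
    show "integrable M (\<lambda>x. F x * c)" using F by simp
    have "g n x \<le> c" for x
      using has_sum_mono2[OF has_sum_finite[of "{n}" "\<lambda>n. g n x"] sum[of x]] g by auto
    then have "F x * g n x \<le> F x * c" for x using F(2) by (intro mult_left_mono) auto
    then have "\<bar>F x * g n x\<bar> \<le> \<bar>F x * c\<bar>" for x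
      using F(2)[of x] g[of n x] by (smt (verit) mult_nonneg_nonneg)
    then show "AE x in M. norm (F x * g n x) \<le> norm (F x * c)" by simp
  qed simp
  have "(\<lambda>N. LINT x|M. (\<Sum>i<N. F x * g (int_decode i) x)) \<longlonglongrightarrow> (LINT x|M. F x * c)"
  proof (rule integral_dominated_convergence[where w = "\<lambda>x. F x * c"])
    show "AE x in M. (\<lambda>N. \<Sum>i<N. F x * g (int_decode i) x) \<longlonglongrightarrow> F x * c"
      using sums_mult[OF sums] by (simp add: sums_def)
    show "AE x in M. norm (\<Sum>i<N. F x * g (int_decode i) x) \<le> F x * c" for N
      using part g F(2) by (intro AE_I2) (simp add: abs_of_nonneg sum_nonneg)
  qed (use F in simp_all)
  then have "(\<lambda>i. LINT x|M. F x * g (int_decode i) x) sums ((LINT x|M. F x) * c)"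
    using int by (simp add: sums_def)
  \<comment> \<open>Nonnegative terms make the convergence absolute, so the enumerated series is
    also the unordered sum.\<close>
  moreover have "(LINT x|M. F x * g n x) \<ge> 0" for n using g F(2) by simp
  ultimately have "((\<lambda>i. LINT x|M. F x * g (int_decode i) x) has_sum ((LINT x|M. F x) * c)) UNIV"
    by (intro norm_summable_imp_has_sum) (simp_all add: sums_iff)
  then show ?thesis by (rule has_sum_reindex_bij_betw[OF bij_int_decode, THEN iffD1])
qed

section \<open>The tight frame\<close>

lemma lborel_integral_shift:
  fixes f :: "real \<Rightarrow> 'a :: {banach, second_countable_topology}"
  shows "(LINT x|lborel. f (x + t)) = (LINT x|lborel. f x)"
  using lborel_integral_real_affine[of 1 f t] by (simp add: add.commute)

lemma lborel_integrable_shift: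
  fixes f :: "real \<Rightarrow> 'a :: {banach, second_countable_topology}"
  shows "integrable lborel f \<Longrightarrow> integrable lborel (\<lambda>x. f (x + t))"
  using lborel_integrable_real_affine[of f 1 t] by (simp add: add.commute)

theorem mainTheorem8:
  fixes A B a0 b0 L p0 q0 chi :: real
    and a b :: "real \<Rightarrow> real"
    and \<psi> :: "real \<Rightarrow> complex"
    and Q :: "real \<Rightarrow> real \<Rightarrow> complex"
    and \<alpha> :: "real \<Rightarrow> int \<Rightarrow> real"
    and \<beta> \<gamma> :: "real \<Rightarrow> int \<Rightarrow> int \<Rightarrow> real"
    and \<Psi> :: "real \<Rightarrow> int \<times> int \<Rightarrow> real \<Rightarrow> complex"
  defines "a \<equiv> \<lambda>\<epsilon>. a0 + A / \<epsilon>"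
    and "b \<equiv> \<lambda>\<epsilon>. b0 - A / \<epsilon>"
    and "p0 \<equiv> pi / (A * L)"
    and "Q \<equiv> \<lambda>\<epsilon> x. of_real (exp (- (1 / 2) * \<epsilon> * x))"
    and "\<alpha> \<equiv> \<lambda>\<epsilon> n. exp (- \<epsilon> * of_int n * q0)"
    and "\<beta> \<equiv> \<lambda>\<epsilon> m n. - (2 * pi * of_int m * exp (- \<epsilon> * of_int n * q0)
                          / (b \<epsilon> * (exp (\<epsilon> * L) - exp (- \<epsilon> * L))))"
    and "\<gamma> \<equiv> \<lambda>\<epsilon> m n. \<beta> \<epsilon> m n * log_quot (\<alpha> \<epsilon> n)"
    and "\<Psi> \<equiv> \<lambda>\<epsilon> (n, m). rho \<epsilon> (a \<epsilon>) (b \<epsilon>) (\<alpha> \<epsilon> n, \<beta> \<epsilon> m n, \<gamma> \<epsilon> m n)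
                          (\<lambda>x. Q \<epsilon> x * \<psi> x)"
  assumes "A \<noteq> 0"
    and "a0 + b0 = B"
    and "\<forall>\<epsilon>\<in>{0<..1}. b \<epsilon> \<noteq> 0"
    and "L > 0"
    and "\<psi> \<in> L2R"
    and "\<not> (AE x in lborel. \<psi> x = 0)"
    and "AE x in lborel. x \<notin> {-L..L} \<longrightarrow> \<psi> x = 0"
    and "\<bar>q0 * p0\<bar> < 2 * pi"
    and "chi > 0"
    and "\<forall>x. ((\<lambda>n::int. (cmod (\<psi> (x + of_int n * q0)))\<^sup>2) has_sum chi) UNIV"
  shows "\<forall>\<epsilon>\<in>{0<..1}. tight_frame (UNIV :: (int \<times> int) set) (\<Psi> \<epsilon>)
           (2 * (sinh (\<epsilon> * L) / \<epsilon>) * chi)"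
proof
  fix \<epsilon> :: real assume \<epsilon>: "\<epsilon> \<in> {0<..1}"
  then have \<epsilon>0: "\<epsilon> > 0" by simp
  have b0: "b \<epsilon> \<noteq> 0" using assms(11) \<epsilon> by blast
  have L: "L > 0" by fact
  have \<psi>_meas [measurable]: "\<psi> \<in> borel_measurable borel"
    and \<psi>2: "integrable lborel (\<lambda>x. (cmod (\<psi> x))\<^sup>2)"
    using \<open>\<psi> \<in> L2R\<close> by (auto simp: L2R_def)
  have supp: "AE x in lborel. x \<notin> {-L..L} \<longrightarrow> \<psi> x = 0" by fact
  have part: "((\<lambda>n::int. (cmod (\<psi> (x + of_int n * q0)))\<^sup>2) has_sum chi) UNIV" for x
    using assms(18) by blast
  \<comment> \<open>The single term n = 0 of the partition. This boundedness is what puts the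
    product of \<open>\<psi>\<close> with a translate of \<open>f\<close> into L^2.\<close>
  have \<psi>_le: "(cmod (\<psi> x))\<^sup>2 \<le> chi" for x
    using has_sum_mono2[OF has_sum_finite[of "{0}" "\<lambda>n::int. (cmod (\<psi> (x + of_int n * q0)))\<^sup>2"] part[of x]]
    by simp
  define D where "D = exp (\<epsilon> * L) - exp (- \<epsilon> * L)"
  have D: "D > 0" using \<epsilon>0 L by (simp add: D_def)
  define K where "K = D / \<epsilon>"
  have K: "2 * (sinh (\<epsilon> * L) / \<epsilon>) = K" using \<epsilon>0 by (simp add: K_def D_def sinh_field_def field_simps)
  define chirp where "chirp m y =
      cis (- (2 * pi * of_int m * exp (- \<epsilon> * y) / D)) * of_real (exp (- (\<epsilon> * y) / 2))" for m :: int and y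
  define phase where "phase m n = cis (a \<epsilon> * \<gamma> \<epsilon> m n)" for m n
  have \<Psi>_eq: "\<Psi> \<epsilon> (n, m) x = phase m n * (chirp m (x + of_int n * q0) * \<psi> (x + of_int n * q0))" for n m x
  proof -
    have sh: "x - ln (\<alpha> \<epsilon> n) / \<epsilon> = x + of_int n * q0"
      using \<epsilon>0 by (simp add: \<alpha>_def)
    have "exp (- \<epsilon> * of_int n * q0) * exp (- \<epsilon> * x) = exp (- \<epsilon> * (x + of_int n * q0))"
      by (simp add: algebra_simps flip: exp_add)
    \<comment> \<open>\<open>b \<epsilon>\<close> cancels against the denominator of
      \<open>\<beta>\<close>; what remains oscillates in u with m full periods over length
      \<open>D\<close>.\<close>
    then have ph: "b \<epsilon> * \<beta> \<epsilon> m n * exp (- \<epsilon> * x) = - (2 * pi * of_int m * exp (- \<epsilon> * (x + of_int n * q0)) / D)"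
      using b0 D unfolding \<beta>_def D_def[symmetric] by (simp add: mult.assoc)
    have Qe: "Q \<epsilon> (x + of_int n * q0) = of_real (exp (- (\<epsilon> * (x + of_int n * q0)) / 2))"
      by (simp add: Q_def)
    show ?thesis
      unfolding \<Psi>_def prod.case rho.simps sh ph Qe chirp_def phase_def cis_conv_exp
      by (simp only: mult.assoc)
  qed
  have cis_meas [measurable]: "cis \<in> borel_measurable borel"
    by (intro borel_measurable_continuous_onI continuous_intros)
  have [measurable]: "chirp m \<in> borel_measurable borel" for m
    unfolding chirp_def by measurable
  have \<Psi>_L2: "\<Psi> \<epsilon> (n, m) \<in> L2R" for n m
  proof -
    have "integrable lborel (\<lambda>y. (cmod (chirp m y * \<psi> y))\<^sup>2)"
    proof (rule Bochner_Integration.integrable_bound)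
      \<comment> \<open>The exponential weight is unbounded on the line; on the support of
        \<open>\<psi>\<close> its square is largest at y = -L.\<close>
      show "integrable lborel (\<lambda>y. exp (\<epsilon> * L) * (cmod (\<psi> y))\<^sup>2)" using \<psi>2 by simp
      show "AE y in lborel. norm ((cmod (chirp m y * \<psi> y))\<^sup>2) \<le> norm (exp (\<epsilon> * L) * (cmod (\<psi> y))\<^sup>2)"
        using supp
      proof eventually_elim
        case (elim y)
        have "(exp (- (\<epsilon> * y) / 2))\<^sup>2 = exp (\<epsilon> * (- y))" by (simp flip: exp_of_nat_mult)
        then have "(cmod (chirp m y * \<psi> y))\<^sup>2 = exp (\<epsilon> * (- y)) * (cmod (\<psi> y))\<^sup>2"
          by (simp add: chirp_def norm_mult power_mult_distrib)
        moreover have "exp (\<epsilon> * (- y)) \<le> exp (\<epsilon> * L)" if "y \<in> {-L..L}"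
          using that \<epsilon>0 unfolding exp_le_cancel_iff by (intro mult_left_mono) auto
        ultimately show ?case using elim
          by (cases "y \<in> {-L..L}") (auto intro: mult_right_mono)
      qed
    qed simp
    from lborel_integrable_shift[OF this, of "of_int n * q0"]
    have "integrable lborel (\<lambda>x. (cmod (\<Psi> \<epsilon> (n, m) x))\<^sup>2)"
      by (simp add: \<Psi>_eq norm_mult phase_def)
    moreover have "\<Psi> \<epsilon> (n, m) \<in> borel_measurable borel"
      unfolding \<Psi>_eq[abs_def] by measurable
    ultimately show ?thesis by (simp add: L2R_def)
  qed
  have frame: "((\<lambda>k. (cmod (L2_inner f (\<Psi> \<epsilon> k)))\<^sup>2) has_sum K * chi * (L2_nrm f)\<^sup>2) UNIV"
    if "f \<in> L2R" for f
  proof -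
    have [measurable]: "f \<in> borel_measurable borel" and f2: "integrable lborel (\<lambda>x. (cmod (f x))\<^sup>2)"
      using that by (auto simp: L2R_def)
    define h where "h n y = cnj (f (y - of_int n * q0)) * \<psi> y" for n :: int and y
    have [measurable]: "h n \<in> borel_measurable borel" for n unfolding h_def by measurable
    have h2: "integrable lborel (\<lambda>y. (cmod (h n y))\<^sup>2)" for n
    proof (rule Bochner_Integration.integrable_bound)
      show "integrable lborel (\<lambda>y. (cmod (f (y + - (of_int n * q0))))\<^sup>2 * chi)"
        using lborel_integrable_shift[OF f2, of "- (of_int n * q0)"] by simp
      show "AE y in lborel. norm ((cmod (h n y))\<^sup>2) \<le> norm ((cmod (f (y + - (of_int n * q0))))\<^sup>2 * chi)"
        using \<psi>_le \<open>chi > 0\<close> by (intro AE_I2)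
          (simp add: h_def norm_mult power_mult_distrib abs_mult mult_left_mono)
    qed simp
    have inner: "cmod (L2_inner f (\<Psi> \<epsilon> (n, m))) = cmod (LINT y|lborel. chirp m y * h n y)" for n m
    proof -
      have "L2_inner f (\<Psi> \<epsilon> (n, m))
          = (LINT x|lborel. phase m n * (chirp m (x + of_int n * q0) * h n (x + of_int n * q0)))"
        unfolding L2_inner_def \<Psi>_eq h_def
        by (intro Bochner_Integration.integral_cong refl) (simp add: mult_ac)
      also have "\<dots> = (LINT y|lborel. phase m n * (chirp m y * h n y))"
        by (rule lborel_integral_shift)
      finally show ?thesis by (simp add: norm_mult phase_def)
    qed
    have inner_sum: "((\<lambda>m. (cmod (L2_inner f (\<Psi> \<epsilon> (n, m))))\<^sup>2) has_sum
        K * (LINT y|lborel. (cmod (h n y))\<^sup>2)) UNIV" for n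
    proof -
      have "AE y in lborel. y \<notin> {-L..L} \<longrightarrow> h n y = 0"
        using supp by eventually_elim (simp add: h_def)
      from chirp_parseval[OF \<epsilon>0 L _ h2 this]
      show ?thesis unfolding inner chirp_def K_def D_def by simp
    qed
    have "(LINT y|lborel. (cmod (h n y))\<^sup>2)
        = (LINT x|lborel. (cmod (f x))\<^sup>2 * (cmod (\<psi> (x + of_int n * q0)))\<^sup>2)" for n
      unfolding lborel_integral_shift[of "\<lambda>y. (cmod (h n y))\<^sup>2" "of_int n * q0", symmetric]
      by (simp add: h_def norm_mult power_mult_distrib)
    moreover have "((\<lambda>n. LINT x|lborel. (cmod (f x))\<^sup>2 * (cmod (\<psi> (x + of_int n * q0)))\<^sup>2) has_sum
        (LINT x|lborel. (cmod (f x))\<^sup>2) * chi) UNIV"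
      by (rule has_sum_integral_partition) (use f2 part in simp_all)
    ultimately have "((\<lambda>n. LINT y|lborel. (cmod (h n y))\<^sup>2) has_sum
        (LINT x|lborel. (cmod (f x))\<^sup>2) * chi) UNIV" by simp
    then have outer: "((\<lambda>n. K * (LINT y|lborel. (cmod (h n y))\<^sup>2)) has_sum
        K * ((LINT x|lborel. (cmod (f x))\<^sup>2) * chi)) UNIV"
      by (rule has_sum_cmult_right)
    have "((\<lambda>k. (cmod (L2_inner f (\<Psi> \<epsilon> k)))\<^sup>2) has_sum
        K * ((LINT x|lborel. (cmod (f x))\<^sup>2) * chi)) (Sigma UNIV (\<lambda>_. UNIV))"
    proof (rule has_sum_SigmaI[OF inner_sum outer])
      \<comment> \<open>All terms are nonnegative, so summability of the iterated sums gives
        summability over pairs.\<close>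
      show "(\<lambda>k. (cmod (L2_inner f (\<Psi> \<epsilon> k)))\<^sup>2) summable_on Sigma UNIV (\<lambda>_. UNIV)"
        by (rule summable_on_SigmaI[OF inner_sum has_sum_imp_summable[OF outer]]) simp
    qed
    then show ?thesis by (simp add: L2_nrm_def mult_ac)
  qed
  have "K * chi > 0" using D \<epsilon>0 \<open>chi > 0\<close> by (simp add: K_def)
  then show "tight_frame (UNIV :: (int \<times> int) set) (\<Psi> \<epsilon>) (2 * (sinh (\<epsilon> * L) / \<epsilon>) * chi)"
    unfolding tight_frame_def K using \<Psi>_L2 frame by auto
qed

end
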